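(* Let $(A_n)_{n\ge 0}$ be a chain of $s\times s$ row stochastic matrices that is an $l_1$-approximation of a balanced asymmetric chain. Then $(A_n)$ is ergodic if and only if it has the absolute infinite flow property.
   Context: A matrix is (row) stochastic if its entries are nonnegative real numbers and each row sums to 1. A chain is a sequence of matrices indexed by $n\ge 0$; the entries of $A_n$ are written $a_{ij}(n)$. Let $S=\{1,\ldots,s\}$; the overbar denotes complementation in $S$. $l_1$-approximation: a chain $(A_n)$ of stochastic matrices is an $l_1$-approximation of a chain $(B_n)$ of stochastic matrices of the same order if $\sum_{n=0}^{\infty}\|A_n-B_n\|<\infty$, where $\|\cdot\|$ is the max norm (maximum of the absolute values of the entries). Balanced asymmetry: a chain $(B_n)$ of stochastic matrices with entries $b_{ij}(n)$ is balanced asymmetric if there exists $M\ge 1$ such that for any two nonempty subsets $S_1,S_2$ of $S$ with the same cardinality, $$\sum_{i\in S_1}\sum_{j\in\bar S_2}b_{ij}(n)\le M\sum_{i\in\bar S_1}\sum_{j\in S_2}b_{ij}(n)\quad\text{for all } n\ge 0.$$ Ergodicity: for $n>k\ge 0$ let $A(n,k)=A_{n-1}A_{n-2}\cdots A_k$. The chain $(A_n)$ is ergodic if for every $k\ge 0$ the limit $\lim_{n\to\infty}A(n,k)$ exists and is a matrix with identical rows. Absolute infinite flow property: the chain $(A_n)$ has the absolute infinite flow property if for every sequence $T(0),T(1),\ldots$ of nonempty proper subsets of $S$, all of the same cardinality, $$\sum_{n=0}^{\infty}\Big(\sum_{i\in T(n+1)}\sum_{j\in\bar T(n)}a_{ij}(n)+\sum_{i\in\bar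 T(n+1)}\sum_{j\in T(n)}a_{ij}(n)\Big)=\infty.$$ If $s=1$, the property holds trivially. *)

theory Defs
  imports "HOL-Analysis.Analysis"
begin

text \<open>
  The index set \<open>S = {1, ..., s}\<close> is the finite type \<open>'s\<close> (so \<open>s \<ge> 1\<close> is automatic), the
  complement of a subset of \<open>S\<close> is the set-theoretic complement in that type, and a chain is a
  function \<open>nat \<Rightarrow> real ^ 's ^ 's\<close>; the entry \<open>a\<^sub>i\<^sub>j(n)\<close> is \<open>A n $ i $ j\<close>.
\<close>

definition row_stochastic :: "real ^ 's ^ 's \<Rightarrow> bool" where
  "row_stochastic P \<longleftrightarrow>
     (\<forall>i j. 0 \<le> P $ i $ j) \<and> (\<forall>i. (\<Sum>j\<in>UNIV. P $ i $ j) = 1)"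

definition stochastic_chain :: "(nat \<Rightarrow> real ^ 's ^ 's) \<Rightarrow> bool" where
  "stochastic_chain A \<longleftrightarrow> (\<forall>n. row_stochastic (A n))"

text \<open>The type-class norm on \<open>real ^ 's ^ 's\<close> is the Euclidean one, not the max norm.\<close>

definition max_norm :: "real ^ 's ^ 's \<Rightarrow> real" where
  "max_norm P = Max {\<bar>P $ i $ j\<bar> | i j. True}"

definition l1_approximation ::
    "(nat \<Rightarrow> real ^ 's ^ 's) \<Rightarrow> (nat \<Rightarrow> real ^ 's ^ 's) \<Rightarrow> bool" where
  "l1_approximation A B \<longleftrightarrow>
     stochastic_chain A \<and> stochastic_chain B \<and> summable (\<lambda>n. max_norm (A n - B n))"

definition balanced_asymmetric :: "(nat \<Rightarrow> real ^ 's ^ 's) \<Rightarrow> bool" where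
  "balanced_asymmetric B \<longleftrightarrow> stochastic_chain B \<and>
     (\<exists>M\<ge>1. \<forall>S1 S2 :: 's set. S1 \<noteq> {} \<longrightarrow> S2 \<noteq> {} \<longrightarrow> card S1 = card S2 \<longrightarrow>
        (\<forall>n. (\<Sum>i\<in>S1. \<Sum>j\<in>- S2. B n $ i $ j)
              \<le> M * (\<Sum>i\<in>- S1. \<Sum>j\<in>S2. B n $ i $ j)))"

text \<open>
  \<open>backward_prod A n k\<close> is \<open>A (n - 1) ** A (n - 2) ** \<dots> ** A k\<close> for \<open>n > k\<close>, and the
  identity matrix (the empty product) for \<open>n \<le> k\<close>.
\<close>

fun backward_prod :: "(nat \<Rightarrow> real ^ 's ^ 's) \<Rightarrow> nat \<Rightarrow> nat \<Rightarrow> real ^ 's ^ 's" where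
  "backward_prod A 0 k = mat 1"
| "backward_prod A (Suc n) k = (if k \<le> n then A n ** backward_prod A n k else mat 1)"

definition ergodic :: "(nat \<Rightarrow> real ^ 's ^ 's) \<Rightarrow> bool" where
  "ergodic A \<longleftrightarrow>
     (\<forall>k. \<exists>L. (\<lambda>n. backward_prod A n k) \<longlonglongrightarrow> L \<and> (\<forall>i j. row i L = row j L))"

definition absolute_infinite_flow :: "(nat \<Rightarrow> real ^ 's ^ 's) \<Rightarrow> bool" where
  "absolute_infinite_flow A \<longleftrightarrow>
     (\<forall>T :: nat \<Rightarrow> 's set.
        (\<forall>n. T n \<noteq> {} \<and> T n \<noteq> UNIV) \<longrightarrow> (\<forall>m n. card (T m) = card (T n)) \<longrightarrow>
        filterlim
          (\<lambda>N. \<Sum>n<N. (\<Sum>i\<in>T (Suc n). \<Sum>j\<in>- T n. A n $ i $ j)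
                     + (\<Sum>i\<in>- T (Suc n). \<Sum>j\<in>T n. A n $ i $ j))
          at_top sequentially)"

end

theory Submission
  imports Defs
begin

text \<open>
  An ergodic stochastic chain has the absolute infinite flow property, balanced or not
  (\<open>ergodic_imp_absolute_infinite_flow\<close>). If the flow along \<open>T\<close> has a finite sum, start at a time
  \<open>k\<close> after which the remaining flow is below \<open>1/4\<close>, from the indicator vector of \<open>T k\<close>.
  Each step mixes \<open>T n\<close> with its complement by at most the flow at time \<open>n\<close>, so the coordinates
  in \<open>T n\<close> stay above \<open>3/4\<close> and the others below \<open>1/4\<close>: there is no consensus.

  For the converse, follow a trajectory \<open>x (n+1) = A n *v x n\<close> and sort its coordinates at each
  time separately, \<open>y n 0 \<le> y n 1 \<le> \<dots>\<close>. Sorting replaces \<open>A n\<close> by a matrix with rows and columns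
  permuted by two unrelated permutations. Balanced asymmetry survives this, because
  its two index sets \<open>S1\<close> and \<open>S2\<close> are independent; an \<open>l\<^sub>1\<close>-approximation keeps it up to a
  summable error. Hence, in the sorted system, what crosses a cut \<open>{0..k}\<close> in one direction is
  bounded by \<open>M\<close> times what crosses it in the other. Now give the sorted values weights that
  decrease geometrically with ratio \<open>q = 1 / (4 * M)\<close>. The pull of the higher values on the lower
  ones then outweighs the pull of the lower values on the higher ones, so the weighted sum
  increases up to a summable error, by at least a multiple of
  \<open>(y n (k+1) - y n k) * (flow across the cut k at time n)\<close> for every \<open>k\<close> (\<open>potential_step\<close>).

  Since the potential is bounded, it converges and the sum of these increments is finite. The same
  argument applies to the weights cut off after the first \<open>l\<close> values, so each sorted value
  converges. The \<open>k + 1\<close> lowest coordinates form a set of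
  constant cardinality, so by assumption the flow along these sets has an infinite sum; the
  summability of gap times flow then forces the limit of every gap to be \<open>0\<close>. All coordinates thus have
  the same limit. Applied to the trajectories that start at the unit vectors, this is ergodicity.
\<close>

section \<open>Two facts about real sequences\<close>

lemma almost_increasing:
  fixes v p d :: "nat \<Rightarrow> real"
  assumes step: "\<And>n. k \<le> n \<Longrightarrow> p n - d n \<le> v (Suc n) - v n"
    and p: "\<And>n. 0 \<le> p n"
    and d: "\<And>n. 0 \<le> d n" "summable d"
    and v: "\<And>n. v n \<le> C"
  shows "convergent v" and "summable p"
proof -
  define u where "u n = v (n + k) + (\<Sum>m<n. d (m + k))" for n
  have dk: "summable (\<lambda>m. d (m + k))"
    using d(2) by (simp add: summable_iff_shift)
  have dsum: "(\<Sum>m<n. d (m + k)) \<le> (\<Sum>m. d (m + k))" for n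
    by (rule sum_le_suminf[OF dk]) (auto simp: d)
  have u_step: "p (n + k) \<le> u (Suc n) - u n" for n
    using step[of "n + k"] by (simp add: u_def)
  have u_le: "u n \<le> C + (\<Sum>m. d (m + k))" for n
    using v[of "n + k"] dsum[of n] by (simp add: u_def)
  have "u n \<le> u (Suc n)" for n
    using u_step[of n] p[of "n + k"] by linarith
  then have "incseq u" by (rule incseq_SucI)
  then obtain L where "u \<longlonglongrightarrow> L"
    using incseq_convergent u_le by blast
  then have "(\<lambda>n. u n - (\<Sum>m<n. d (m + k))) \<longlonglongrightarrow> L - (\<Sum>m. d (m + k))"
    using dk by (intro tendsto_diff summable_LIMSEQ)
  then have "(\<lambda>n. v (n + k)) \<longlonglongrightarrow> L - (\<Sum>m. d (m + k))"
    by (simp add: u_def)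
  then show "convergent v"
    using LIMSEQ_offset convergentI by blast
  have sum_p: "(\<Sum>m<n. p (m + k)) \<le> u n - u 0" for n
  proof (induction n)
    case (Suc n)
    then show ?case using u_step[of n] by simp
  qed simp
  have "(\<Sum>m<n. p (m + k)) \<le> C + (\<Sum>m. d (m + k)) - u 0" for n
    using sum_p[of n] u_le[of n] by simp
  then have "summable (\<lambda>m. p (m + k))"
    using p by (intro bounded_imp_summable[where B = "C + (\<Sum>m. d (m + k)) - u 0"])
      (simp_all only: lessThan_Suc_atMost[symmetric])
  then show "summable p"
    by (simp add: summable_iff_shift)
qed

lemma partial_sums_at_top_iff_not_summable:
  fixes f :: "nat \<Rightarrow> real"
  assumes f: "\<And>n. 0 \<le> f n"
  shows "filterlim (\<lambda>N. \<Sum>n<N. f n) at_top sequentially \<longleftrightarrow> \<not> summable f"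
proof
  assume top: "filterlim (\<lambda>N. \<Sum>n<N. f n) at_top sequentially"
  show "\<not> summable f"
  proof
    assume "summable f"
    then show False
      using not_tendsto_and_filterlim_at_infinity[OF sequentially_bot summable_LIMSEQ
        filterlim_at_top_imp_at_infinity[OF top]] by blast
  qed
next
  assume ns: "\<not> summable f"
  show "filterlim (\<lambda>N. \<Sum>n<N. f n) at_top sequentially"
    unfolding filterlim_at_top eventually_sequentially
  proof
    fix Z
    have "\<exists>N. \<not> (\<Sum>n<N. f n) \<le> Z"
      using ns f bounded_imp_summable[of f Z] 
      by (metis lessThan_Suc_atMost)
    then obtain N where N: "Z \<le> (\<Sum>n<N. f n)"
      by (auto simp: not_le intro: less_imp_le)
    have "Z \<le> (\<Sum>n<n'. f n)" if "N \<le> n'" for n'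
      using N sum_mono2[of "{..<n'}" "{..<N}" f] that f by fastforce
    then show "\<exists>N. \<forall>n'\<ge>N. Z \<le> (\<Sum>n<n'. f n)" by blast
  qed
qed

section \<open>Weighted sums of sorted values under averaging\<close>

text \<open>
  Writing \<open>y j - y i\<close> as a signed sum of the gaps between \<open>i\<close> and \<open>j\<close> decomposes the change of
  the weighted sum into one term per cut \<open>{0..k}\<close>: rows below the cut are pulled up through the
  gap and rows above it are pulled down. As \<open>w\<close> is antimonotone, the upward pulls weigh at least
  \<open>w k\<close> and the downward pulls at most \<open>w (Suc k)\<close>.
\<close>

lemma sorted_weighted_increment:
  fixes c :: "nat \<Rightarrow> nat \<Rightarrow> real" and y w :: "nat \<Rightarrow> real" and s :: nat
  assumes nonneg: "\<And>i j. i < s \<Longrightarrow> j < s \<Longrightarrow> 0 \<le> c i j"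
    and rows: "\<And>i. i < s \<Longrightarrow> (\<Sum>j<s. c i j) = 1"
    and y: "\<And>k. Suc k < s \<Longrightarrow> y k \<le> y (Suc k)"
    and w: "antimono w"
  shows "(\<Sum>k<s - 1. (y (Suc k) - y k) *
            (w k * (\<Sum>i\<in>{..k}. \<Sum>j\<in>{k<..<s}. c i j)
             - w (Suc k) * (\<Sum>i\<in>{k<..<s}. \<Sum>j\<in>{..k}. c i j)))
         \<le> (\<Sum>i<s. w i * ((\<Sum>j<s. c i j * y j) - y i))"
proof -
  define g where "g k = y (Suc k) - y k" for k
  define h where "h k i = (\<Sum>j<s. c i j * (of_bool (k < j) - of_bool (k < i)))" for k i
  have tel: "y j = y 0 + (\<Sum>k<s - 1. g k * of_bool (k < j))" if "j < s" for j
  proof -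
    have "y j - y 0 = (\<Sum>k<j. g k)"
      unfolding g_def by (simp add: sum_lessThan_telescope)
    also have "\<dots> = (\<Sum>k<s - 1. g k * of_bool (k < j))"
      using that by (intro sum.mono_neutral_cong_left) auto
    finally show ?thesis by simp
  qed
  have drift: "(\<Sum>j<s. c i j * y j) - y i = (\<Sum>k<s - 1. g k * h k i)" if i: "i < s" for i
  proof -
    have "(\<Sum>j<s. c i j * y j) - y i = (\<Sum>j<s. c i j * (y j - y i))"
      using rows[OF i] by (simp add: right_diff_distrib sum_subtractf flip: sum_distrib_right)
    also have "\<dots> = (\<Sum>j<s. c i j * (\<Sum>k<s - 1. g k * (of_bool (k < j) - of_bool (k < i))))"
    proof (rule sum.cong[OF refl])
      fix j assume "j \<in> {..<s}"
      then have "y j - y i = (\<Sum>k<s - 1. g k * (of_bool (k < j) - of_bool (k < i)))"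
        using tel[of j] tel[OF i] by (simp add: right_diff_distrib sum_subtractf)
      then show "c i j * (y j - y i) =
          c i j * (\<Sum>k<s - 1. g k * (of_bool (k < j) - of_bool (k < i)))" by simp
    qed
    also have "\<dots> = (\<Sum>k<s - 1. g k * h k i)"
      unfolding h_def sum_distrib_left by (subst sum.swap) (simp add: mult.left_commute)
    finally show ?thesis .
  qed
  have cut: "w k * (\<Sum>i\<in>{..k}. \<Sum>j\<in>{k<..<s}. c i j)
             - w (Suc k) * (\<Sum>i\<in>{k<..<s}. \<Sum>j\<in>{..k}. c i j) \<le> (\<Sum>i<s. w i * h k i)"
    if k: "k < s - 1" for k
  proof -
    have split: "{..<s} = {..k} \<union> {k<..<s}" using k by auto
    define up where "up i = (\<Sum>j\<in>{k<..<s}. c i j)" for i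
    define down where "down i = (\<Sum>j\<in>{..k}. c i j)" for i
    have up: "h k i = up i" if "i \<le> k" for i
      unfolding h_def up_def using that by (intro sum.mono_neutral_cong_right) auto
    have down: "h k i = - down i" if "k < i" for i
      unfolding h_def down_def sum_negf[symmetric] using that k
      by (intro sum.mono_neutral_cong_right) auto
    have "w k * (\<Sum>i\<in>{..k}. up i) \<le> (\<Sum>i\<in>{..k}. w i * h k i)"
      unfolding sum_distrib_left
    proof (rule sum_mono)
      fix i assume i: "i \<in> {..k}"
      have "0 \<le> up i"
        unfolding up_def using i k by (intro sum_nonneg nonneg) auto
      then show "w k * up i \<le> w i * h k i"
        using i up antimonoD[OF w, of i k] by (simp add: mult_right_mono)
    qed
    moreover have "- (w (Suc k) * (\<Sum>i\<in>{k<..<s}. down i)) \<le> (\<Sum>i\<in>{k<..<s}. w i * h k i)"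
      unfolding sum_distrib_left sum_negf[symmetric]
    proof (rule sum_mono)
      fix i assume i: "i \<in> {k<..<s}"
      have "0 \<le> down i"
        unfolding down_def using i k by (intro sum_nonneg nonneg) auto
      then show "- (w (Suc k) * down i) \<le> w i * h k i"
        using i down antimonoD[OF w, of "Suc k" i] by (simp add: mult_right_mono)
    qed
    ultimately show ?thesis
      unfolding split up_def[symmetric] down_def[symmetric] by (subst sum.union_disjoint) auto
  qed
  have "(\<Sum>k<s - 1. g k * (w k * (\<Sum>i\<in>{..k}. \<Sum>j\<in>{k<..<s}. c i j)
             - w (Suc k) * (\<Sum>i\<in>{k<..<s}. \<Sum>j\<in>{..k}. c i j)))
        \<le> (\<Sum>k<s - 1. g k * (\<Sum>i<s. w i * h k i))"
    using y by (intro sum_mono mult_left_mono cut) (auto simp: g_def)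
  also have "\<dots> = (\<Sum>i<s. w i * (\<Sum>k<s - 1. g k * h k i))"
    unfolding sum_distrib_left by (subst sum.swap) (simp add: mult.left_commute)
  also have "\<dots> = (\<Sum>i<s. w i * ((\<Sum>j<s. c i j * y j) - y i))"
    using drift by (intro sum.cong) auto
  finally show ?thesis unfolding g_def .
qed

section \<open>Flow along a sequence of sets\<close>

definition flow :: "(nat \<Rightarrow> real ^ 's ^ 's) \<Rightarrow> (nat \<Rightarrow> 's set) \<Rightarrow> nat \<Rightarrow> real" where
  "flow A T n = (\<Sum>i\<in>T (Suc n). \<Sum>j\<in>- T n. A n $ i $ j)
              + (\<Sum>i\<in>- T (Suc n). \<Sum>j\<in>T n. A n $ i $ j)"

lemma flow_nonneg:
  assumes "stochastic_chain A"
  shows "0 \<le> flow A T n"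
  using assms unfolding flow_def stochastic_chain_def row_stochastic_def
  by (intro add_nonneg_nonneg sum_nonneg) auto

lemma absolute_infinite_flow_iff:
  assumes "stochastic_chain A"
  shows "absolute_infinite_flow A \<longleftrightarrow>
     (\<forall>T. (\<forall>n. T n \<noteq> {} \<and> T n \<noteq> UNIV) \<longrightarrow> (\<forall>m n. card (T m) = card (T n)) \<longrightarrow>
        \<not> summable (flow A T))"
  unfolding absolute_infinite_flow_def flow_def[symmetric]
  by (simp add: partial_sums_at_top_iff_not_summable[OF flow_nonneg[OF assms]])

section \<open>Trajectories of almost balanced chains\<close>

lemma sorting_enumeration:
  fixes f :: "'s::finite \<Rightarrow> real"
  obtains \<sigma> where "bij_betw \<sigma> {..<CARD('s)} UNIV"
    and "\<And>j k. j \<le> k \<Longrightarrow> k < CARD('s) \<Longrightarrow> f (\<sigma> j) \<le> f (\<sigma> k)"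
proof -
  obtain xs :: "'s list" where xs: "set xs = UNIV" "distinct xs"
    using finite_distinct_list[OF finite, of "UNIV :: 's set"] by auto
  define ys where "ys = sort_key f xs"
  have ys: "set ys = UNIV" "distinct ys" using xs by (auto simp: ys_def)
  then have len: "length ys = CARD('s)" using distinct_card by metis
  have "bij_betw (\<lambda>k. ys ! k) {..<CARD('s)} UNIV"
    using bij_betw_nth[of ys] ys len by simp
  moreover have "f (ys ! j) \<le> f (ys ! k)" if "j \<le> k" "k < CARD('s)" for j k
    using sorted_nth_mono[of "map f ys" j k] that len by (simp add: ys_def)
  ultimately show ?thesis using that by blast
qed

text \<open>
  At time \<open>n\<close> the permutation \<open>\<sigma> n\<close> lists the indices in increasing order of the coordinates
  of \<open>x n\<close>. The error \<open>d\<close> absorbs the distance from an exactly balanced chain. The recursion is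
  required only from \<open>start\<close> on, because the backward products that begin at time \<open>start\<close>
  are constant before it.
\<close>

locale sorted_trajectory =
  fixes A :: "nat \<Rightarrow> real ^ 's ^ 's" and M :: real and d :: "nat \<Rightarrow> real"
    and x :: "nat \<Rightarrow> real ^ 's" and start :: nat and \<sigma> :: "nat \<Rightarrow> nat \<Rightarrow> 's"
  assumes stochastic: "stochastic_chain A"
    and M: "1 \<le> M"
    and d_nonneg: "0 \<le> d n"
    and d_summable: "summable d"
    and balanced: "S1 \<noteq> {} \<Longrightarrow> S2 \<noteq> {} \<Longrightarrow> card S1 = card S2 \<Longrightarrow>
        (\<Sum>i\<in>S1. \<Sum>j\<in>- S2. A n $ i $ j) \<le> M * (\<Sum>i\<in>- S1. \<Sum>j\<in>S2. A n $ i $ j) + d n"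
    and recursion: "start \<le> n \<Longrightarrow> x (Suc n) = A n *v x n"
    and range: "0 \<le> x n $ i" "x n $ i \<le> 1"
    and enum: "bij_betw (\<sigma> n) {..<CARD('s)} UNIV"
    and sorted: "j \<le> k \<Longrightarrow> k < CARD('s) \<Longrightarrow> x n $ \<sigma> n j \<le> x n $ \<sigma> n k"
begin

definition y :: "nat \<Rightarrow> nat \<Rightarrow> real" where "y n k = x n $ \<sigma> n k"

definition T :: "nat \<Rightarrow> nat \<Rightarrow> 's set" where "T k n = \<sigma> n ` {..k}"

definition q :: real where "q = 1 / (4 * M)"

lemma q: "0 < q" "q \<le> 1"
  using M by (auto simp: q_def)

lemma inj: "K \<subseteq> {..<CARD('s)} \<Longrightarrow> inj_on (\<sigma> n) K"
  using enum[of n] by (meson bij_betw_def inj_on_subset)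

lemma y_mono: "j \<le> k \<Longrightarrow> k < CARD('s) \<Longrightarrow> y n j \<le> y n k"
  unfolding y_def by (rule sorted)

lemma compl_T:
  assumes "k < CARD('s)"
  shows "- T k n = \<sigma> n ` {k<..<CARD('s)}"
proof -
  have "{..<CARD('s)} = {..k} \<union> {k<..<CARD('s)}" using assms by auto
  then have "\<sigma> n ` {..k} \<union> \<sigma> n ` {k<..<CARD('s)} = UNIV"
    using enum[of n] by (metis bij_betw_imp_surj_on image_Un)
  moreover have "\<sigma> n ` {..k} \<inter> \<sigma> n ` {k<..<CARD('s)} = \<sigma> n ` ({..k} \<inter> {k<..<CARD('s)})"
    using assms by (intro inj_on_image_Int[OF inj[OF order_refl], symmetric]) auto
  ultimately show ?thesis unfolding T_def by auto
qed

lemma T_proper: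
  assumes "Suc k < CARD('s)"
  shows "T k n \<noteq> {}" "T k n \<noteq> UNIV" "card (T k n) = Suc k" "- T k n \<noteq> {}"
proof -
  show c: "card (T k n) = Suc k"
    unfolding T_def using assms by (subst card_image) (auto intro: inj)
  show "T k n \<noteq> {}" using c by auto
  show "T k n \<noteq> UNIV" using c assms by auto
  then show "- T k n \<noteq> {}" by blast
qed

definition c :: "nat \<Rightarrow> nat \<Rightarrow> nat \<Rightarrow> real" where
  "c n i j = A n $ \<sigma> (Suc n) i $ \<sigma> n j"

lemma c_sum:
  assumes "I \<subseteq> {..<CARD('s)}" "J \<subseteq> {..<CARD('s)}"
  shows "(\<Sum>i\<in>I. \<Sum>j\<in>J. c n i j) = (\<Sum>i\<in>\<sigma> (Suc n) ` I. \<Sum>j\<in>\<sigma> n ` J. A n $ i $ j)"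
  unfolding c_def by (simp add: sum.reindex inj assms)

text \<open>
  Let \<open>U\<close> and \<open>L\<close> be the flows across the cut that pull up and down. Balance, applied to the complements
  of the sets of the \<open>k + 1\<close> lowest indices at times \<open>n + 1\<close> and \<open>n\<close>, gives
  \<open>L \<le> M * U + d n\<close>, hence \<open>U + L \<le> 2 * M * U + d n\<close>. So up to the error \<open>U\<close> is
  at least \<open>2 * q * (U + L)\<close>; the weight ratio \<open>q\<close> spends at most half of this on the downward pull.
\<close>

lemma cut_lower_bound:
  assumes k: "Suc k < CARD('s)" and w: "0 \<le> w k" "w (Suc k) \<le> q * w k"
  shows "w k * (q * flow A (T k) n - d n)
    \<le> w k * (\<Sum>i\<in>{..k}. \<Sum>j\<in>{k<..<CARD('s)}. c n i j)
      - w (Suc k) * (\<Sum>i\<in>{k<..<CARD('s)}. \<Sum>j\<in>{..k}. c n i j)"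
proof -
  define U where "U = (\<Sum>i\<in>{..k}. \<Sum>j\<in>{k<..<CARD('s)}. c n i j)"
  define L where "L = (\<Sum>i\<in>{k<..<CARD('s)}. \<Sum>j\<in>{..k}. c n i j)"
  have k': "k < CARD('s)" using k by simp
  have U: "U = (\<Sum>i\<in>T k (Suc n). \<Sum>j\<in>- T k n. A n $ i $ j)"
    unfolding U_def compl_T[OF k'] unfolding T_def using k by (intro c_sum) auto
  have L: "L = (\<Sum>i\<in>- T k (Suc n). \<Sum>j\<in>T k n. A n $ i $ j)"
    unfolding L_def compl_T[OF k'] unfolding T_def using k by (intro c_sum) auto
  have "0 \<le> U" "0 \<le> L"
    unfolding U L using stochastic unfolding stochastic_chain_def row_stochastic_def
    by (auto intro!: sum_nonneg)
  have F: "flow A (T k) n = U + L" by (simp add: flow_def U L)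
  have "card (- T k (Suc n)) = card (- T k n)"
    using T_proper(3)[OF k] by (simp add: Compl_eq_Diff_UNIV card_Diff_subset)
  then have "L \<le> M * U + d n"
    unfolding L U using balanced[of "- T k (Suc n)" "- T k n" n] T_proper(4)[OF k] by simp
  moreover have "U \<le> M * U" using M \<open>0 \<le> U\<close> by (simp add: mult_le_cancel_right1)
  ultimately have "U + L \<le> 2 * M * U + d n" by linarith
  then have "q * (U + L) \<le> q * (2 * M * U + d n)" using q by (intro mult_left_mono) auto
  also have "\<dots> = U / 2 + q * d n" using M by (simp add: q_def field_simps)
  finally have "2 * q * (U + L) \<le> U + 2 * q * d n" by simp
  moreover have "2 * q * d n \<le> d n"
    using M d_nonneg[of n] by (intro mult_left_le_one_le) (auto simp: q_def field_simps)
  moreover have "q * L \<le> q * (U + L)" using q \<open>0 \<le> U\<close> by simp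
  ultimately have "q * (U + L) - d n \<le> U - q * L" by linarith
  then have "w k * (q * (U + L) - d n) \<le> w k * (U - q * L)" using w by (intro mult_left_mono)
  also have "\<dots> = w k * U - q * w k * L" by (simp add: algebra_simps)
  also have "\<dots> \<le> w k * U - w (Suc k) * L"
    using w \<open>0 \<le> L\<close> by (intro diff_left_mono mult_right_mono) auto
  finally show ?thesis unfolding F U_def[symmetric] L_def[symmetric] .
qed

lemma potential_step:
  assumes n: "start \<le> n"
    and w: "\<And>k. 0 \<le> w k" "\<And>k. w k \<le> 1" "\<And>k. w (Suc k) \<le> q * w k"
  shows "(\<Sum>k<CARD('s) - 1. q * w k * ((y n (Suc k) - y n k) * flow A (T k) n)) - CARD('s) * d n
    \<le> (\<Sum>i<CARD('s). w i * y (Suc n) i) - (\<Sum>i<CARD('s). w i * y n i)"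
proof -
  let ?s = "CARD('s)"
  define g where "g k = y n (Suc k) - y n k" for k
  have g: "0 \<le> g k" "g k \<le> 1" if "k < ?s - 1" for k
  proof -
    show "0 \<le> g k" using y_mono[of k "Suc k" n] that by (simp add: g_def)
    show "g k \<le> 1"
      using range(1)[of n "\<sigma> n k"] range(2)[of n "\<sigma> n (Suc k)"] by (simp add: g_def y_def)
  qed
  have w_anti: "antimono w"
  proof (rule antimonoI, erule dec_induct)
    fix k m assume "w m \<le> w k"
    moreover have "q * w m \<le> w m" using q w by (intro mult_left_le_one_le) auto
    ultimately show "w (Suc m) \<le> w k" using w(3)[of m] by linarith
  qed simp
  have sum_enum: "(\<Sum>j<?s. f (\<sigma> n j)) = (\<Sum>j\<in>UNIV. f j)" for f :: "'s \<Rightarrow> real"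
    using sum.reindex_bij_betw[OF enum] by blast
  have c_nonneg: "0 \<le> c n i j" for i j
    using stochastic by (auto simp: c_def stochastic_chain_def row_stochastic_def)
  have c_rows: "(\<Sum>j<?s. c n i j) = 1" for i
    unfolding c_def sum_enum using stochastic
    by (auto simp: stochastic_chain_def row_stochastic_def)
  have y_Suc: "y (Suc n) i = (\<Sum>j<?s. c n i j * y n j)" for i
    unfolding c_def y_def sum_enum[of "\<lambda>j. A n $ \<sigma> (Suc n) i $ j * x n $ j"]
    by (simp add: recursion[OF n] matrix_vector_mult_def)
  have "(\<Sum>k<?s - 1. q * w k * (g k * flow A (T k) n)) - ?s * d n
      \<le> (\<Sum>k<?s - 1. q * w k * (g k * flow A (T k) n)) - (\<Sum>k<?s - 1. d n)"
    using d_nonneg[of n] by (simp add: mult_right_mono)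
  also have "\<dots> = (\<Sum>k<?s - 1. q * w k * (g k * flow A (T k) n) - d n)"
    by (simp only: sum_subtractf)
  also have "\<dots> \<le> (\<Sum>k<?s - 1. g k * (w k * (q * flow A (T k) n - d n)))"
  proof (rule sum_mono)
    fix k assume "k \<in> {..<?s - 1}"
    then have "g k * w k \<le> 1" using g[of k] w by (intro mult_le_one) auto
    then have "g k * w k * d n \<le> d n"
      using d_nonneg g[of k] w \<open>k \<in> _\<close> by (intro mult_left_le_one_le) auto
    then show "q * w k * (g k * flow A (T k) n) - d n
        \<le> g k * (w k * (q * flow A (T k) n - d n))"
      by (simp add: algebra_simps)
  qed
  also have "\<dots> \<le> (\<Sum>k<?s - 1. g k *
            (w k * (\<Sum>i\<in>{..k}. \<Sum>j\<in>{k<..<?s}. c n i j)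
             - w (Suc k) * (\<Sum>i\<in>{k<..<?s}. \<Sum>j\<in>{..k}. c n i j)))"
    using g w by (intro sum_mono mult_left_mono cut_lower_bound) auto
  also have "\<dots> \<le> (\<Sum>i<?s. w i * ((\<Sum>j<?s. c n i j * y n j) - y n i))"
    unfolding g_def
    by (rule sorted_weighted_increment) (auto simp: c_nonneg c_rows w_anti intro: y_mono)
  also have "\<dots> = (\<Sum>i<?s. w i * y (Suc n) i) - (\<Sum>i<?s. w i * y n i)"
    by (simp add: y_Suc right_diff_distrib sum_subtractf)
  finally show ?thesis unfolding g_def .
qed

lemma potential_converges:
  assumes w: "\<And>k. 0 \<le> w k" "\<And>k. w k \<le> 1" "\<And>k. w (Suc k) \<le> q * w k"
  shows "convergent (\<lambda>n. \<Sum>i<CARD('s). w i * y n i)"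
    and "summable (\<lambda>n. \<Sum>k<CARD('s) - 1. q * w k * ((y n (Suc k) - y n k) * flow A (T k) n))"
proof -
  have 1: "0 \<le> (\<Sum>k<CARD('s) - 1. q * w k * ((y n (Suc k) - y n k) * flow A (T k) n))" for n
    using w q flow_nonneg[OF stochastic] by (intro sum_nonneg mult_nonneg_nonneg) (auto intro: y_mono)
  have 2: "0 \<le> CARD('s) * d n" for n using d_nonneg by simp
  have 3: "summable (\<lambda>n. CARD('s) * d n)" using d_summable by (rule summable_mult)
  have 4: "(\<Sum>i<CARD('s). w i * y n i) \<le> (\<Sum>i<CARD('s). 1)" for n
    using w range by (intro sum_mono mult_le_one) (auto simp: y_def)
  note * = almost_increasing[OF potential_step[of _ w, OF _ w] 1 2 3 4]
  show "convergent (\<lambda>n. \<Sum>i<CARD('s). w i * y n i)" by (rule *(1))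
  show "summable (\<lambda>n. \<Sum>k<CARD('s) - 1. q * w k * ((y n (Suc k) - y n k) * flow A (T k) n))"
    by (rule *(2))
qed

text \<open>
  Replacing \<open>w\<close> by \<open>0\<close> from some index on preserves the conditions on the weights. Therefore all
  partial weighted sums converge, and so do the single values as their differences.
\<close>

lemma sorted_values_converge:
  assumes m: "m < CARD('s)"
  shows "convergent (\<lambda>n. y n m)"
proof -
  have V: "convergent (\<lambda>n. \<Sum>i<l. q ^ i * y n i)" if l: "l \<le> CARD('s)" for l
  proof -
    have "convergent (\<lambda>n. \<Sum>i<CARD('s). (if i < l then q ^ i else 0) * y n i)"
      using q by (intro potential_converges(1)) (auto simp: power_le_one)
    moreover have "(\<Sum>i<CARD('s). (if i < l then q ^ i else 0) * y n i) = (\<Sum>i<l. q ^ i * y n i)"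
      for n using l by (intro sum.mono_neutral_cong_right) auto
    ultimately show ?thesis by simp
  qed
  have "convergent (\<lambda>n. inverse (q ^ m) * ((\<Sum>i<Suc m. q ^ i * y n i) - (\<Sum>i<m. q ^ i * y n i)))"
    using m by (intro convergent_mult convergent_diff V convergent_const) auto
  then show ?thesis using q by (simp add: mult.assoc[symmetric])
qed

lemma gap_times_flow_summable:
  assumes k: "Suc k < CARD('s)"
  shows "summable (\<lambda>n. (y n (Suc k) - y n k) * flow A (T k) n)"
proof -
  let ?p = "\<lambda>n k. q * q ^ k * ((y n (Suc k) - y n k) * flow A (T k) n)"
  have "summable (\<lambda>n. \<Sum>k<CARD('s) - 1. ?p n k)"
    using q by (intro potential_converges(2)) (auto simp: power_le_one)
  moreover have nonneg: "0 \<le> ?p n k" if "Suc k < CARD('s)" for n k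
    using that q flow_nonneg[OF stochastic] by (intro mult_nonneg_nonneg) (auto intro: y_mono)
  moreover have "?p n k \<le> (\<Sum>k<CARD('s) - 1. ?p n k)" for n
    using k nonneg by (intro member_le_sum) auto
  ultimately have "summable (\<lambda>n. ?p n k)"
    using k by (intro summable_comparison_test'[where N=0 and f="\<lambda>n. ?p n k"]) auto
  then show ?thesis using q by (simp add: summable_cmult_iff)
qed

text \<open>
  A gap with a positive limit would make the flow along \<open>T k\<close> summable by comparison with gap
  times flow, although these sets all have cardinality \<open>k + 1\<close>.
\<close>

lemma gap_vanishes:
  assumes aif: "absolute_infinite_flow A" and k: "Suc k < CARD('s)"
  shows "(\<lambda>n. y n (Suc k) - y n k) \<longlonglongrightarrow> 0"
proof -
  let ?g = "\<lambda>n. y n (Suc k) - y n k"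
  obtain l where l: "?g \<longlonglongrightarrow> l"
    using sorted_values_converge k convergent_diff[of "\<lambda>n. y n (Suc k)" "\<lambda>n. y n k"]
    by (auto simp: convergent_def[of ?g])
  have "0 \<le> l"
    using k by (intro LIMSEQ_le_const[OF l]) (simp add: y_mono)
  moreover have "\<not> 0 < l"
  proof
    assume "0 < l"
    then have "eventually (\<lambda>n. l / 2 < ?g n) sequentially"
      by (intro order_tendstoD(1)[OF l]) simp
    then have "eventually (\<lambda>n. norm (flow A (T k) n) \<le> 2 / l * (?g n * flow A (T k) n)) sequentially"
    proof eventually_elim
      case (elim n)
      then have "l / 2 * flow A (T k) n \<le> ?g n * flow A (T k) n"
        using flow_nonneg[OF stochastic] by (intro mult_right_mono) auto
      then show ?case
        using \<open>0 < l\<close> flow_nonneg[OF stochastic, of "T k" n] by (simp add: field_simps)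
    qed
    then have "summable (flow A (T k))"
      using summable_mult[OF gap_times_flow_summable[OF k]] by (rule summable_comparison_test_ev)
    then show False
      using aif T_proper[OF k] unfolding absolute_infinite_flow_iff[OF stochastic] by metis
  qed
  ultimately show ?thesis using l by simp
qed

lemma consensus:
  assumes aif: "absolute_infinite_flow A"
  shows "\<exists>L. \<forall>i. (\<lambda>n. x n $ i) \<longlonglongrightarrow> L"
proof -
  obtain L where L: "(\<lambda>n. y n 0) \<longlonglongrightarrow> L"
    using sorted_values_converge[of 0] by (auto simp: convergent_def)
  have all: "k < CARD('s) \<Longrightarrow> (\<lambda>n. y n k) \<longlonglongrightarrow> L" for k
  proof (induction k)
    case (Suc k)
    then show ?case using tendsto_add[OF Suc.IH gap_vanishes[OF aif, of k]] by simp
  qed (rule L)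
  have "(\<lambda>n. x n $ i) \<longlonglongrightarrow> L" for i
  proof (rule tendsto_sandwich[OF _ _ L all[of "CARD('s) - 1"]])
    have between: "y n 0 \<le> x n $ i \<and> x n $ i \<le> y n (CARD('s) - 1)" for n
    proof -
      obtain k where "k < CARD('s)" "i = \<sigma> n k"
        using enum[of n] by (metis UNIV_I bij_betw_imp_surj_on imageE lessThan_iff)
      then show ?thesis using y_mono[of 0 k n] y_mono[of k "CARD('s) - 1" n] by (simp add: y_def)
    qed
    show "\<forall>\<^sub>F n in sequentially. y n 0 \<le> x n $ i" using between by simp
    show "\<forall>\<^sub>F n in sequentially. x n $ i \<le> y n (CARD('s) - 1)" using between by simp
  qed simp
  then show ?thesis by blast
qed

end

section \<open>Approximations of balanced chains\<close>

lemma max_norm_ge_entry: "\<bar>P $ i $ j\<bar> \<le> max_norm P"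
proof -
  have "{\<bar>P $ i $ j\<bar> | i j. True} = range (\<lambda>(i, j). \<bar>P $ i $ j\<bar>)" by auto
  then have "finite {\<bar>P $ i $ j\<bar> | i j. True}" by simp
  then show ?thesis unfolding max_norm_def by (rule Max_ge) blast
qed

lemma block_sum_diff_le:
  fixes P Q :: "real ^ 's ^ 's"
  shows "(\<Sum>i\<in>I. \<Sum>j\<in>J. P $ i $ j) - (\<Sum>i\<in>I. \<Sum>j\<in>J. Q $ i $ j)
    \<le> (real CARD('s))\<^sup>2 * max_norm (P - Q)"
proof -
  have nonneg: "0 \<le> max_norm (P - Q)" using max_norm_ge_entry[of "P - Q"] by (meson abs_ge_zero order_trans)
  have "(\<Sum>i\<in>I. \<Sum>j\<in>J. P $ i $ j) - (\<Sum>i\<in>I. \<Sum>j\<in>J. Q $ i $ j)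
      = (\<Sum>i\<in>I. \<Sum>j\<in>J. (P - Q) $ i $ j)"
    by (simp add: sum_subtractf)
  also have "\<dots> \<le> (\<Sum>i\<in>I. \<Sum>j\<in>J. max_norm (P - Q))"
    by (intro sum_mono) (metis abs_ge_self max_norm_ge_entry order_trans)
  also have "\<dots> \<le> (\<Sum>i\<in>(UNIV :: 's set). \<Sum>j\<in>(UNIV :: 's set). max_norm (P - Q))"
    using nonneg
    by (intro order_trans[OF sum_mono[OF sum_mono2] sum_mono2] sum_nonneg) auto
  finally show ?thesis by (simp add: power2_eq_square)
qed

text \<open>
  Exchanging \<open>A\<close> and \<open>B\<close> changes each of the two block sums by at most \<open>e n\<close>, once as it stands and
  once multiplied by \<open>M\<close>, which gives the error \<open>(M + 1) * e n\<close>.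
\<close>

lemma l1_approximation_almost_balanced:
  fixes A B :: "nat \<Rightarrow> real ^ 's ^ 's"
  assumes "balanced_asymmetric B" and "l1_approximation A B"
  obtains M d where "1 \<le> M" "\<And>n. 0 \<le> d n" "summable d"
    "\<And>S1 S2 n. S1 \<noteq> {} \<Longrightarrow> S2 \<noteq> {} \<Longrightarrow> card S1 = card S2 \<Longrightarrow>
      (\<Sum>i\<in>S1. \<Sum>j\<in>- S2. A n $ i $ j) \<le> M * (\<Sum>i\<in>- S1. \<Sum>j\<in>S2. A n $ i $ j) + d n"
proof -
  obtain M where M: "1 \<le> M" and bal: "\<And>S1 S2 n. S1 \<noteq> {} \<Longrightarrow> S2 \<noteq> {} \<Longrightarrow> card S1 = card S2 \<Longrightarrow>
      (\<Sum>i\<in>S1. \<Sum>j\<in>- S2. B n $ i $ j) \<le> M * (\<Sum>i\<in>- S1. \<Sum>j\<in>S2. B n $ i $ j)"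
    using assms(1) unfolding balanced_asymmetric_def by metis
  define e where "e n = (real CARD('s))\<^sup>2 * max_norm (A n - B n)" for n
  have "max_norm (B n - A n) = max_norm (A n - B n)" for n
    unfolding max_norm_def by (simp add: abs_minus_commute)
  then have e': "(real CARD('s))\<^sup>2 * max_norm (B n - A n) = e n" for n by (simp add: e_def)
  have e_nonneg: "0 \<le> e n" for n
    using max_norm_ge_entry[of "A n - B n"] unfolding e_def
    by (intro mult_nonneg_nonneg) (auto intro: order_trans[OF abs_ge_zero])
  have "summable e" using assms(2) unfolding e_def l1_approximation_def by (intro summable_mult) auto
  show ?thesis
  proof (rule that[of M "\<lambda>n. (M + 1) * e n"])
    show "1 \<le> M" by (rule M)
    show "0 \<le> (M + 1) * e n" for n using M e_nonneg[of n] by simp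
    show "summable (\<lambda>n. (M + 1) * e n)" using \<open>summable e\<close> by (rule summable_mult)
    fix S1 S2 :: "'s set" and n
    assume S: "S1 \<noteq> {}" "S2 \<noteq> {}" "card S1 = card S2"
    have "(\<Sum>i\<in>S1. \<Sum>j\<in>- S2. A n $ i $ j) \<le> (\<Sum>i\<in>S1. \<Sum>j\<in>- S2. B n $ i $ j) + e n"
      using block_sum_diff_le[where P="A n" and Q="B n" and I=S1 and J="- S2"] by (simp add: e_def)
    also have "\<dots> \<le> M * (\<Sum>i\<in>- S1. \<Sum>j\<in>S2. B n $ i $ j) + e n" using bal[OF S] by simp
    also have "\<dots> \<le> M * ((\<Sum>i\<in>- S1. \<Sum>j\<in>S2. A n $ i $ j) + e n) + e n"
      using block_sum_diff_le[where P="B n" and Q="A n" and I="- S1" and J=S2] M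
      by (intro add_right_mono mult_left_mono) (auto simp: e')
    finally show "(\<Sum>i\<in>S1. \<Sum>j\<in>- S2. A n $ i $ j)
        \<le> M * (\<Sum>i\<in>- S1. \<Sum>j\<in>S2. A n $ i $ j) + (M + 1) * e n"
      by (simp add: algebra_simps)
  qed
qed

section \<open>Ergodicity and infinite flow\<close>

lemma row_stochastic_average:
  assumes P: "row_stochastic P" and v: "\<And>j. a \<le> v $ j" "\<And>j. v $ j \<le> b"
  shows "a \<le> (P *v v) $ i" "(P *v v) $ i \<le> b"
proof -
  have nn: "\<And>j. 0 \<le> P $ i $ j" and one: "(\<Sum>j\<in>UNIV. P $ i $ j) = 1"
    using P by (auto simp: row_stochastic_def)
  have "(\<Sum>j\<in>UNIV. P $ i $ j * a) \<le> (P *v v) $ i"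
    unfolding matrix_vector_mult_def using nn v by (auto intro!: sum_mono mult_left_mono)
  then show "a \<le> (P *v v) $ i" using one by (simp flip: sum_distrib_right)
  have "(P *v v) $ i \<le> (\<Sum>j\<in>UNIV. P $ i $ j * b)"
    unfolding matrix_vector_mult_def using nn v by (auto intro!: sum_mono mult_left_mono)
  then show "(P *v v) $ i \<le> b" using one by (simp flip: sum_distrib_right)
qed

lemma backward_prod_start: "n \<le> k \<Longrightarrow> backward_prod A n k = mat 1"
  by (cases n) auto

lemma trajectory_range:
  assumes A: "stochastic_chain A" and v: "\<And>j. a \<le> v $ j" "\<And>j. v $ j \<le> b"
  shows "a \<le> (backward_prod A n k *v v) $ i \<and> (backward_prod A n k *v v) $ i \<le> b"
proof (induction n arbitrary: i)
  case (Suc n)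
  have "row_stochastic (A n)" using A by (simp add: stochastic_chain_def)
  note row_stochastic_average[OF this, of a "backward_prod A n k *v v" b i]
  then show ?case using Suc v by (auto simp: matrix_vector_mul_assoc[symmetric])
qed (use v in simp)

text \<open>
  Each column of the backward product is the trajectory that starts at a unit vector at time \<open>k\<close>.
\<close>

theorem almost_balanced_infinite_flow_imp_ergodic:
  fixes A :: "nat \<Rightarrow> real ^ 's ^ 's"
  assumes A: "stochastic_chain A" and aif: "absolute_infinite_flow A"
    and M: "1 \<le> M" and d: "\<And>n. 0 \<le> d n" "summable d"
    and bal: "\<And>S1 S2 n. S1 \<noteq> {} \<Longrightarrow> S2 \<noteq> {} \<Longrightarrow> card S1 = card S2 \<Longrightarrow>
      (\<Sum>i\<in>S1. \<Sum>j\<in>- S2. A n $ i $ j) \<le> M * (\<Sum>i\<in>- S1. \<Sum>j\<in>S2. A n $ i $ j) + d n"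
  shows "ergodic A"
  unfolding ergodic_def
proof
  fix k
  have "\<exists>L. \<forall>i. (\<lambda>n. backward_prod A n k $ i $ l) \<longlonglongrightarrow> L" for l
  proof -
    define x where "x n = backward_prod A n k *v axis l 1" for n
    have "\<forall>n. \<exists>\<tau>. bij_betw \<tau> {..<CARD('s)} UNIV \<and>
        (\<forall>i j. i \<le> j \<longrightarrow> j < CARD('s) \<longrightarrow> x n $ \<tau> i \<le> x n $ \<tau> j)"
      by (metis sorting_enumeration)
    then obtain \<sigma> where \<sigma>: "\<And>n. bij_betw (\<sigma> n) {..<CARD('s)} UNIV"
        "\<And>n i j. i \<le> j \<Longrightarrow> j < CARD('s) \<Longrightarrow> x n $ \<sigma> n i \<le> x n $ \<sigma> n j"
      by metis
    have range: "0 \<le> x n $ i \<and> x n $ i \<le> 1" for n i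
      unfolding x_def by (rule trajectory_range[OF A]) (auto simp: axis_def)
    have "sorted_trajectory A M d x k \<sigma>"
    proof
      show "x (Suc n) = A n *v x n" if "k \<le> n" for n
        using that by (simp add: x_def matrix_vector_mul_assoc)
    qed (use A M d bal range \<sigma> in auto)
    then have "\<exists>L. \<forall>i. (\<lambda>n. x n $ i) \<longlonglongrightarrow> L" using aif by (rule sorted_trajectory.consensus)
    then show ?thesis by (simp add: x_def matrix_vector_mult_basis column_def)
  qed
  then obtain L where L: "\<And>i l. (\<lambda>n. backward_prod A n k $ i $ l) \<longlonglongrightarrow> L l" by metis
  have "(\<lambda>n. backward_prod A n k) \<longlonglongrightarrow> (\<chi> i l. L l)"
    using L by (intro vec_tendstoI) simp
  moreover have "row i (\<chi> i l. L l) = row j (\<chi> i l. L l)" for i j :: 's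
    by (simp add: row_def)
  ultimately show "\<exists>L. (\<lambda>n. backward_prod A n k) \<longlonglongrightarrow> L \<and> (\<forall>i j. row i L = row j L)" by blast
qed


text \<open>
  The indicator of \<open>T k\<close> stays separated: if \<open>r\<close> bounds the deviation from the indicator of
  \<open>T n\<close> at time \<open>n\<close>, then a row in \<open>T (Suc n)\<close> puts at most the mass \<open>flow A T n\<close> outside \<open>T n\<close>, and
  symmetrically for the complement, so \<open>r + flow A T n\<close> bounds the deviation one step later.
\<close>

theorem ergodic_imp_absolute_infinite_flow:
  fixes A :: "nat \<Rightarrow> real ^ 's ^ 's"
  assumes A: "stochastic_chain A" and erg: "ergodic A"
  shows "absolute_infinite_flow A"
  unfolding absolute_infinite_flow_iff[OF A]
proof (intro allI impI notI)
  fix T :: "nat \<Rightarrow> 's set"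
  assume T: "\<forall>n. T n \<noteq> {} \<and> T n \<noteq> UNIV" and sm: "summable (flow A T)"
  obtain k where "\<And>n. norm (\<Sum>m\<in>{k..<n}. flow A T m) < 1/4"
    using sm unfolding summable_Cauchy by (metis divide_pos_pos le_refl zero_less_numeral zero_less_one)
  then have tail: "(\<Sum>m\<in>{k..<n}. flow A T m) < 1/4" for n
    by (metis abs_ge_self order_le_less_trans real_norm_def)
  define v :: "real ^ 's" where "v = (\<chi> i. of_bool (i \<in> T k))"
  define x where "x n = backward_prod A n k *v v" for n
  have range: "0 \<le> x n $ i \<and> x n $ i \<le> 1" for n i
    unfolding x_def by (rule trajectory_range[OF A]) (auto simp: v_def)
  have sep: "(\<forall>i\<in>T n. 1 - (\<Sum>m\<in>{k..<n}. flow A T m) \<le> x n $ i) \<and>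
             (\<forall>i\<in>- T n. x n $ i \<le> (\<Sum>m\<in>{k..<n}. flow A T m))" if "k \<le> n" for n
    using that
  proof (induction n rule: dec_induct)
    case base
    show ?case by (simp add: x_def v_def backward_prod_start)
  next
    case (step n)
    define r where "r = (\<Sum>m\<in>{k..<n}. flow A T m)"
    have r: "(\<Sum>m\<in>{k..<Suc n}. flow A T m) = r + flow A T n"
      using step.hyps by (simp add: r_def)
    have "0 \<le> r" unfolding r_def by (intro sum_nonneg flow_nonneg[OF A])
    have nn: "\<And>i j. 0 \<le> A n $ i $ j" and one: "\<And>i. (\<Sum>j\<in>UNIV. A n $ i $ j) = 1"
      using A by (auto simp: stochastic_chain_def row_stochastic_def)
    have lower: "1 - x n $ j \<le> r + of_bool (j \<in> - T n)" for j
      using step.IH range[of n j] \<open>0 \<le> r\<close> by (cases "j \<in> T n") (fastforce simp: r_def)+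
    have upper: "x n $ j \<le> r + of_bool (j \<in> T n)" for j
      using step.IH range[of n j] \<open>0 \<le> r\<close> by (cases "j \<in> T n") (auto simp: r_def)
    have x_Suc: "x (Suc n) $ i = (\<Sum>j\<in>UNIV. A n $ i $ j * x n $ j)" for i
      using step.hyps
      by (simp add: x_def matrix_vector_mul_assoc[symmetric] matrix_vector_mult_def[of "A n"])
    have out: "(\<Sum>j\<in>- T n. A n $ i $ j) \<le> flow A T n" if "i \<in> T (Suc n)" for i
      unfolding flow_def using that nn
      by (intro add_increasing2 member_le_sum[where f="\<lambda>i. \<Sum>j\<in>- T n. A n $ i $ j"] sum_nonneg) auto
    have into: "(\<Sum>j\<in>T n. A n $ i $ j) \<le> flow A T n" if "i \<in> - T (Suc n)" for i
      unfolding flow_def using that nn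
      by (intro add_increasing member_le_sum[where f="\<lambda>i. \<Sum>j\<in>T n. A n $ i $ j"] sum_nonneg) auto
    have restrict: "(\<Sum>j\<in>UNIV. A n $ i $ j * of_bool (j \<in> J)) = (\<Sum>j\<in>J. A n $ i $ j)" for i J
      by (intro sum.mono_neutral_cong_right) auto
    have smear: "(\<Sum>j\<in>UNIV. A n $ i $ j * (r + of_bool (j \<in> J))) = r + (\<Sum>j\<in>J. A n $ i $ j)"
      for i J
      by (simp only: distrib_left sum.distrib restrict one mult_1 flip: sum_distrib_right)
    have "1 - (r + flow A T n) \<le> x (Suc n) $ i" if i: "i \<in> T (Suc n)" for i
    proof -
      have "1 - x (Suc n) $ i = (\<Sum>j\<in>UNIV. A n $ i $ j * (1 - x n $ j))"
        using one by (simp add: x_Suc right_diff_distrib sum_subtractf)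
      also have "\<dots> \<le> (\<Sum>j\<in>UNIV. A n $ i $ j * (r + of_bool (j \<in> - T n)))"
        using lower nn by (intro sum_mono mult_left_mono) auto
      also have "\<dots> = r + (\<Sum>j\<in>- T n. A n $ i $ j)"
        by (rule smear)
      finally show ?thesis using out[OF i] by linarith
    qed
    moreover have "x (Suc n) $ i \<le> r + flow A T n" if i: "i \<in> - T (Suc n)" for i
    proof -
      have "x (Suc n) $ i \<le> (\<Sum>j\<in>UNIV. A n $ i $ j * (r + of_bool (j \<in> T n)))"
        unfolding x_Suc using upper nn by (intro sum_mono mult_left_mono) auto
      also have "\<dots> = r + (\<Sum>j\<in>T n. A n $ i $ j)"
        by (rule smear)
      finally show ?thesis using into[OF i] by linarith
    qed
    ultimately show ?case unfolding r by blast
  qed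
  obtain L where L: "(\<lambda>n. backward_prod A n k) \<longlonglongrightarrow> L" and rows: "\<And>i j. row i L = row j L"
    using erg unfolding ergodic_def by blast
  \<comment> \<open>The rows of \<open>L\<close> agree, so \<open>L *v v\<close> is constant and any coordinate can name its value.\<close>
  define z where "z = (L *v v) $ undefined"
  have z: "(L *v v) $ i = z" for i
    using rows[of i undefined] by (simp add: z_def matrix_vector_mult_def row_def vec_eq_iff)
  have "(\<lambda>n. x n $ i) \<longlonglongrightarrow> z" for i
    unfolding z[of i, symmetric] x_def matrix_vector_mult_def
    by (auto intro!: tendsto_intros tendsto_vec_nth L)
  then have "eventually (\<lambda>n. dist (x n $ i) z < 1/4) sequentially" for i
    by (rule tendstoD) simp
  then have "eventually (\<lambda>n. \<forall>i\<in>UNIV. dist (x n $ i) z < 1/4) sequentially"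
    by (intro eventually_ball_finite) auto
  then have "eventually (\<lambda>n. (\<forall>i. dist (x n $ i) z < 1/4) \<and> k \<le> n) sequentially"
    using eventually_ge_at_top[of k] by eventually_elim simp
  then obtain n where n: "\<And>i. dist (x n $ i) z < 1/4" "k \<le> n"
    using eventually_happens'[OF sequentially_bot] by blast
  obtain i j where "i \<in> T n" "j \<in> - T n" using T by blast
  then have "1 - (\<Sum>m\<in>{k..<n}. flow A T m) \<le> x n $ i" "x n $ j \<le> (\<Sum>m\<in>{k..<n}. flow A T m)"
    using sep[OF n(2)] by auto
  then show False
    using tail[of n] n(1)[of i] n(1)[of j] by (simp add: dist_real_def abs_if split: if_splits)
qed

theorem theorem2:
  fixes A B :: "nat \<Rightarrow> real ^ 's ^ 's"
  assumes "stochastic_chain A"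
    and "balanced_asymmetric B"
    and "l1_approximation A B"
  shows "ergodic A \<longleftrightarrow> absolute_infinite_flow A"
proof
  assume "ergodic A"
  then show "absolute_infinite_flow A" using assms(1) by (intro ergodic_imp_absolute_infinite_flow)
next
  assume "absolute_infinite_flow A"
  obtain M d where "1 \<le> M" "\<And>n. 0 \<le> d n" "summable d"
    "\<And>S1 S2 n. S1 \<noteq> {} \<Longrightarrow> S2 \<noteq> {} \<Longrightarrow> card S1 = card S2 \<Longrightarrow>
      (\<Sum>i\<in>S1. \<Sum>j\<in>- S2. A n $ i $ j) \<le> M * (\<Sum>i\<in>- S1. \<Sum>j\<in>S2. A n $ i $ j) + d n"
    using l1_approximation_almost_balanced[OF assms(2,3)] by blast
  then show "ergodic A"
    using assms(1) \<open>absolute_infinite_flow A\<close>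
    by (intro almost_balanced_infinite_flow_imp_ergodic)
qed

end
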